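(* Suppose $X_1,\dots,X_n$ are i.i.d. $\mathrm{Exp}(\theta)$ with rate $\theta>0$. For any $\delta\in(0,1)$, let $m=(n\log n)^{2/3}\log^{1/3}(1/\delta)$. Then the stopping policy $\tau$ of the algorithm CDP-OL with horizon $n$, exploration length $m$ and confidence parameter $\delta$ satisfies $$\mathrm{CR}_n(\tau;\theta)\ge(1-\delta)\left(1-O\!\left(\frac{\log^{1/3}(1/\delta)}{(n\log n)^{1/3}}\right)-O\!\left(\frac1{\log n}\right)\right).$$
   Context: $\mathrm{Exp}(\theta)$ is the distribution with $F_\theta(x)=1-\exp(-\theta x)$ for $x\ge0$. Stopping problem: the rewards $X_1,\dots,X_n$ are observed sequentially, with $\theta$ unknown to the policy. A policy is a stopping time $\tau$ adapted to $(X_t)$, with reward $X_\tau$. $\mathrm{OPT}(\theta):=\mathbb E_\theta[\max_{t\in[n]}X_t]$ and $\mathrm{CR}_n(\tau;\theta):=\mathbb E_\theta[X_\tau]/\mathrm{OPT}(\theta)$. Algorithm CDP-OL for exponential rewards (horizon $n$, exploration length $m<n$, confidence parameter $\delta$): reject $X_1,\dots,X_m$. Put $\widehat\theta_m=m/\sum_{i=1}^mX_i$, $\varepsilon_m=\sqrt{4\log(2/\delta)/m}$, $\theta^{(\mathrm U)}=(1+\varepsilon_m)\widehat\theta_m$, $N=n-m$. Compute $\widehat V_N=1/\theta^{(\mathrm U)}$ and $\widehat V_i=\widehat V_{i+1}+\exp(-\theta^{(\mathrm U)}\widehat V_{i+1})/\theta^{(\mathrm U)}$ for $i=N-1,\dots,1$.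 Then $\tau=m+t$ for the smallest $t\in\{1,\dots,N-1\}$ with $X_{m+t}\ge\widehat V_{t+1}$, and $\tau=n$ if no such $t$ exists. The exploration length is a number of periods, so the displayed value of $m$ is understood rounded up to an integer. Asymptotic notation is as $n\to\infty$. *)

theory Defs
  imports "HOL-Probability.Probability"
begin

text \<open>Performance of a policy \<open>\<tau>\<close>, given as a random index. The rewards are
  \<open>X 1, \<dots>, X n\<close>; the value \<open>X 0\<close> is not used.\<close>

definition OPT :: "'a measure \<Rightarrow> nat \<Rightarrow> (nat \<Rightarrow> 'a \<Rightarrow> real) \<Rightarrow> real" where
  "OPT M n X = (\<integral>\<omega>. (MAX t\<in>{1..n}. X t \<omega>) \<partial>M)"

definition CR :: "'a measure \<Rightarrow> nat \<Rightarrow> (nat \<Rightarrow> 'a \<Rightarrow> real) \<Rightarrow> ('a \<Rightarrow> nat) \<Rightarrow> real" where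
  "CR M n X \<tau> = (\<integral>\<omega>. X (\<tau> \<omega>) \<omega> \<partial>M) / OPT M n X"

text \<open>The algorithm. Below, \<open>x\<close> is the observed sequence of rewards \<open>x 1, x 2, \<dots>\<close>.\<close>

definition theta_hat :: "nat \<Rightarrow> (nat \<Rightarrow> real) \<Rightarrow> real" where
  "theta_hat m x = real m / (\<Sum>i=1..m. x i)"

definition conf_width :: "nat \<Rightarrow> real \<Rightarrow> real" where
  "conf_width m \<delta> = sqrt (4 * ln (2 / \<delta>) / real m)"

definition theta_U :: "nat \<Rightarrow> real \<Rightarrow> (nat \<Rightarrow> real) \<Rightarrow> real" where
  "theta_U m \<delta> x = (1 + conf_width m \<delta>) * theta_hat m x"

text \<open>The backward recursion of the dynamic program for rate \<open>\<theta>\<close>, indexed by the number of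
  steps \<open>k = N - i\<close> taken back from the last period.\<close>

primrec dp_back :: "real \<Rightarrow> nat \<Rightarrow> real" where
  "dp_back \<theta> 0 = 1 / \<theta>"
| "dp_back \<theta> (Suc k) = dp_back \<theta> k + exp (- \<theta> * dp_back \<theta> k) / \<theta>"

definition dp_value :: "real \<Rightarrow> nat \<Rightarrow> nat \<Rightarrow> real" where
  "dp_value \<theta> N i = dp_back \<theta> (N - i)"

text \<open>Acceptance in exploitation period \<open>t\<close>, i.e.\ at time \<open>m + t\<close>.\<close>

definition cdp_accepts :: "nat \<Rightarrow> nat \<Rightarrow> real \<Rightarrow> (nat \<Rightarrow> real) \<Rightarrow> nat \<Rightarrow> bool" where
  "cdp_accepts n m \<delta> x t \<longleftrightarrow>
     t \<in> {1..n - m - 1} \<and> x (m + t) \<ge> dp_value (theta_U m \<delta> x) (n - m) (t + 1)"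

definition cdp_ol :: "nat \<Rightarrow> nat \<Rightarrow> real \<Rightarrow> (nat \<Rightarrow> real) \<Rightarrow> nat" where
  "cdp_ol n m \<delta> x =
     (if \<exists>t. cdp_accepts n m \<delta> x t then m + (LEAST t. cdp_accepts n m \<delta> x t) else n)"

definition explore_len :: "nat \<Rightarrow> real \<Rightarrow> nat" where
  "explore_len n \<delta> =
     nat \<lceil>(real n * ln (real n)) powr (2 / 3) * ln (1 / \<delta>) powr (1 / 3)\<rceil>"

end

theory Submission
  imports Defs "HOL-Real_Asymp.Real_Asymp"
begin

text \<open>Let \<open>v\<^sub>k\<close> be the optimal value with \<open>k\<close> periods left after the current one for rate 1, so
  that \<open>ln (k + 1) \<le> v\<^sub>k \<le> ln (2k + 3)\<close> and the optimal value for rate \<open>\<theta>\<close> is \<open>v\<^sub>k / \<theta>\<close>. As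
  \<open>m\<close> is of larger order than \<open>(ln n)\<^sup>2\<close>, Chebyshev's inequality shows that with probability
  at least \<open>1 - \<delta>\<close> the relative error of the upper confidence rate is \<open>O(1 / ln n)\<close>; then
  every threshold used is within \<open>1 / (2\<theta>)\<close> of the optimal one. Backward induction over the
  periods shows that such thresholds lose at most \<open>2 / \<theta>\<close> altogether. The reward is thus at
  least \<open>(1 - \<delta>) (ln n - 3) / \<theta>\<close>, while the expected maximum is at most
  \<open>(ln n + 1) / \<theta>\<close>. For fixed \<open>\<delta>\<close> the first error term of the
  theorem is of smaller order than \<open>1 / ln n\<close>, so only the second one matters.\<close>

section \<open>One threshold decision on an exponential reward\<close>

text \<open>By memorylessness, the excess of \<open>Y\<close> over \<open>a\<close> given acceptance
  again has mean \<open>1 / \<theta>\<close>. The expectation is the value of one decision with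
  threshold \<open>a\<close> and continuation value \<open>c\<close>.\<close>

lemma (in prob_space) exponential_distributed_truncated_expectation:
  assumes D: "distributed M lborel Y (exponential_density \<theta>)" and "\<theta> > 0" "a \<ge> 0"
  shows "expectation (\<lambda>\<omega>. if a \<le> Y \<omega> then Y \<omega> else c)
    = exp (- \<theta> * a) * (a + 1 / \<theta>) + (1 - exp (- \<theta> * a)) * c"
proof -
  have Y [measurable]: "random_variable borel Y"
    using distributed_measurable[OF D] by simp
  have tail: "has_bochner_integral M (\<lambda>\<omega>. Y \<omega> * indicator {a..} (Y \<omega>)) (exp (- \<theta> * a) * (a + 1 / \<theta>))"
  proof (rule has_bochner_integral_nn_integral)
    have "(\<integral>\<^sup>+\<omega>. ennreal (Y \<omega> * indicator {a..} (Y \<omega>)) \<partial>M)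
        = (\<integral>\<^sup>+y. ennreal (exponential_density \<theta> y) * ennreal (y * indicator {a..} y) \<partial>lborel)"
      by (rule distributed_nn_integral[symmetric, OF D]) simp
    also have "\<dots> = (\<integral>\<^sup>+y. ennreal (\<theta> * y * exp (- \<theta> * y)) * indicator {a..} y \<partial>lborel)"
      using assms by (intro nn_integral_cong)
        (auto simp: exponential_density_def ennreal_mult[symmetric] mult_ac split: split_indicator)
    also have "\<dots> = ennreal (0 - (- (exp (- \<theta> * a) * (a + 1 / \<theta>))))"
    proof (rule nn_integral_FTC_atLeast)
      show "((\<lambda>y. - (exp (- \<theta> * y) * (y + 1 / \<theta>))) has_real_derivative \<theta> * y * exp (- \<theta> * y)) (at y)" for y
        using \<open>\<theta> > 0\<close> by (auto intro!: derivative_eq_intros simp: field_simps)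
      show "((\<lambda>y. - (exp (- \<theta> * y) * (y + 1 / \<theta>))) \<longlongrightarrow> 0) at_top"
        using \<open>\<theta> > 0\<close> by real_asymp
    qed (use assms in auto)
    finally show "(\<integral>\<^sup>+\<omega>. ennreal (Y \<omega> * indicator {a..} (Y \<omega>)) \<partial>M)
        = ennreal (exp (- \<theta> * a) * (a + 1 / \<theta>))" by simp
  qed (use assms in \<open>auto split: split_indicator\<close>)
  \<comment> \<open>The tail formula for the exponential law concerns \<open>a < Y\<close>, whereas
    the policy also accepts on equality; the difference is a null event.\<close>
  have "AE \<omega> in M. Y \<omega> \<noteq> a"
    by (subst distributed_AE2[OF D]) (auto intro!: AE_I'[of "{a}"])
  have "prob {\<omega> \<in> space M. a < Y \<omega>} = exp (- \<theta> * a)"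
    using exponential_distributedD_gt[OF D] assms by (simp add: mult.commute)
  also have "prob {\<omega> \<in> space M. a < Y \<omega>} = prob {\<omega> \<in> space M. a \<le> Y \<omega>}"
    using \<open>AE \<omega> in M. Y \<omega> \<noteq> a\<close> by (intro finite_measure_eq_AE) auto
  finally have P: "prob {\<omega> \<in> space M. a \<le> Y \<omega>} = exp (- \<theta> * a)" .
  have "expectation (\<lambda>\<omega>. if a \<le> Y \<omega> then Y \<omega> else c)
      = expectation (\<lambda>\<omega>. Y \<omega> * indicator {a..} (Y \<omega>) + (c - c * indicator {\<omega> \<in> space M. a \<le> Y \<omega>} \<omega>))"
    by (intro Bochner_Integration.integral_cong) (auto split: split_indicator)
  also have "\<dots> = exp (- \<theta> * a) * (a + 1 / \<theta>) + (c - c * exp (- \<theta> * a))"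
    using tail P
    by (subst Bochner_Integration.integral_add)
       (auto simp: prob_space has_bochner_integral_iff emeasure_eq_measure
         intro!: Bochner_Integration.integrable_diff integrable_mult_right)
  finally show ?thesis by (simp add: algebra_simps)
qed

text \<open>Fubini on the joint law, which is a product by independence. It plays the part of
  conditioning on \<open>H\<close>: the history stays fixed while \<open>Y\<close> is averaged over
  a fresh sample point.\<close>

lemma (in prob_space) indep_var_expectation_fst:
  fixes f :: "'b \<times> 'b \<Rightarrow> real"
  assumes ind: "indep_var S H T Y"
    and [measurable]: "f \<in> borel_measurable (S \<Otimes>\<^sub>M T)"
    and int: "integrable M (\<lambda>\<omega>. f (H \<omega>, Y \<omega>))"
  shows "integrable M (\<lambda>\<omega>. expectation (\<lambda>\<omega>'. f (H \<omega>, Y \<omega>')))" (is ?int)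
    and "expectation (\<lambda>\<omega>. f (H \<omega>, Y \<omega>)) = expectation (\<lambda>\<omega>. expectation (\<lambda>\<omega>'. f (H \<omega>, Y \<omega>')))" (is ?eq)
proof -
  have [measurable]: "random_variable S H" "random_variable T Y"
    and pair: "distr M S H \<Otimes>\<^sub>M distr M T Y = distr M (S \<Otimes>\<^sub>M T) (\<lambda>\<omega>. (H \<omega>, Y \<omega>))"
    using ind by (auto simp: indep_var_distribution_eq)
  interpret H: prob_space "distr M S H" by (rule prob_space_distr) simp
  interpret Y: prob_space "distr M T Y" by (rule prob_space_distr) simp
  interpret HY: pair_prob_space "distr M S H" "distr M T Y" ..
  have int': "integrable (distr M S H \<Otimes>\<^sub>M distr M T Y) f"
    unfolding pair by (subst integrable_distr_eq) (use int in auto)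
  have inner: "(\<integral>y. f (x, y) \<partial>distr M T Y) = expectation (\<lambda>\<omega>'. f (x, Y \<omega>'))" if "x \<in> space S" for x
    using that by (intro integral_distr) auto
  have meas: "(\<lambda>x. \<integral>y. f (x, y) \<partial>distr M T Y) \<in> borel_measurable S"
    using borel_measurable_integrable[OF HY.integrable_fst'[OF int']] by simp
  have "integrable M (\<lambda>\<omega>. \<integral>y. f (H \<omega>, y) \<partial>distr M T Y)"
    using HY.integrable_fst'[OF int'] by (subst (asm) integrable_distr_eq) (use meas in auto)
  then show ?int
    by (subst Bochner_Integration.integrable_cong[OF refl inner[symmetric]]) (auto intro: measurable_space)
  have "expectation (\<lambda>\<omega>. f (H \<omega>, Y \<omega>)) = integral\<^sup>L (distr M S H \<Otimes>\<^sub>M distr M T Y) f"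
    unfolding pair by (subst integral_distr) auto
  also have "\<dots> = (\<integral>x. (\<integral>y. f (x, y) \<partial>distr M T Y) \<partial>distr M S H)"
    by (rule HY.integral_fst'[OF int', symmetric])
  also have "\<dots> = expectation (\<lambda>\<omega>. \<integral>y. f (H \<omega>, y) \<partial>distr M T Y)"
    by (rule integral_distr) (use meas in auto)
  also have "\<dots> = expectation (\<lambda>\<omega>. expectation (\<lambda>\<omega>'. f (H \<omega>, Y \<omega>')))"
    by (intro Bochner_Integration.integral_cong refl inner) (auto intro: measurable_space)
  finally show ?eq .
qed

text \<open>Think of \<open>H\<close> as the past, \<open>P\<close> as the event that the policy
  still runs, \<open>a\<close> as a threshold computed from the past, and \<open>c\<close> as a
  deterministic continuation value. With the past frozen, the value of the decision is explicit and
  at least \<open>l\<close>; averaging over the past gives the claim.\<close>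

lemma (in prob_space) threshold_step_bound:
  fixes X :: "'i \<Rightarrow> 'a \<Rightarrow> real"
  assumes ind: "indep_vars (\<lambda>_. borel) X I" and J: "J \<subseteq> I" "s \<in> I" "s \<notin> J"
    and D: "distributed M lborel (X s) (exponential_density \<theta>)" and \<theta>: "\<theta> > 0"
    and [measurable]: "Measurable.pred (\<Pi>\<^sub>M i\<in>J. borel) P" "a \<in> borel_measurable (\<Pi>\<^sub>M i\<in>J. borel)"
    and a: "\<And>h. P h \<Longrightarrow> 0 \<le> a h"
    and l: "\<And>h. P h \<Longrightarrow> l \<le> exp (- \<theta> * a h) * (a h + 1 / \<theta>) + (1 - exp (- \<theta> * a h)) * c"
  defines "H \<equiv> \<lambda>\<omega>. restrict (\<lambda>i. X i \<omega>) J"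
  shows "l * prob {\<omega> \<in> space M. P (H \<omega>)}
    \<le> expectation (\<lambda>\<omega>. of_bool (P (H \<omega>)) * (if a (H \<omega>) \<le> X s \<omega> then X s \<omega> else c))"
proof -
  \<comment> \<open>The single reward \<open>X s\<close> is read as a family over
    \<open>{s}\<close>, the form in which independence of disjoint blocks is available.\<close>
  let ?S = "\<Pi>\<^sub>M i\<in>J. borel :: real measure" and ?T = "\<Pi>\<^sub>M i\<in>{s}. borel :: real measure"
  let ?Y = "\<lambda>\<omega>. restrict (\<lambda>i. X i \<omega>) {s}"
  have HY: "indep_var ?S H ?T ?Y"
    unfolding H_def using J by (intro indep_var_restrict[OF ind]) auto
  have [measurable]: "random_variable ?S H" "random_variable ?T ?Y" "random_variable borel (X s)"
    using HY distributed_measurable[OF D] by (auto simp: indep_var_distribution_eq)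
  define f where "f = (\<lambda>(h, y). of_bool (P h) * (if a h \<le> y s then y s else c) :: real)"
  have f [measurable]: "f \<in> borel_measurable (?S \<Otimes>\<^sub>M ?T)"
    unfolding f_def by measurable
  have "integrable M (X s)"
    using erlang_ith_moment_integrable[OF \<theta> D, of 1] by simp
  then have bound: "integrable M (\<lambda>\<omega>. \<bar>X s \<omega>\<bar> + \<bar>c\<bar>)" by simp
  have int: "integrable M (\<lambda>\<omega>. f (H \<omega>, ?Y \<omega>))"
    by (rule Bochner_Integration.integrable_bound[OF bound]) (auto simp: f_def)
  have "l * prob {\<omega> \<in> space M. P (H \<omega>)} = expectation (\<lambda>\<omega>. l * indicator {\<omega> \<in> space M. P (H \<omega>)} \<omega>)"
    by simp
  also have "\<dots> \<le> expectation (\<lambda>\<omega>. expectation (\<lambda>\<omega>'. f (H \<omega>, ?Y \<omega>')))"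
  proof (rule integral_mono)
    fix \<omega> assume "\<omega> \<in> space M"
    then show "l * indicator {\<omega> \<in> space M. P (H \<omega>)} \<omega> \<le> expectation (\<lambda>\<omega>'. f (H \<omega>, ?Y \<omega>'))"
      using a l exponential_distributed_truncated_expectation[OF D \<theta>]
      by (cases "P (H \<omega>)") (auto simp: f_def cong: if_cong)
  next
    show "integrable M (\<lambda>\<omega>. expectation (\<lambda>\<omega>'. f (H \<omega>, ?Y \<omega>')))"
      by (rule indep_var_expectation_fst(1)[OF HY f int])
  qed (simp add: emeasure_eq_measure)
  also have "\<dots> = expectation (\<lambda>\<omega>. f (H \<omega>, ?Y \<omega>))"
    by (rule indep_var_expectation_fst(2)[OF HY f int, symmetric])
  finally show ?thesis by (simp add: f_def cong: if_cong)
qed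

section \<open>Bounds on the expected maximum\<close>

lemma integrable_Max:
  fixes X :: "'i \<Rightarrow> 'a \<Rightarrow> real"
  assumes "finite I" "I \<noteq> {}" and X: "\<And>i. i \<in> I \<Longrightarrow> integrable M (X i)"
  shows "integrable M (\<lambda>\<omega>. MAX i\<in>I. X i \<omega>)"
proof (rule Bochner_Integration.integrable_bound)
  show "integrable M (\<lambda>\<omega>. \<Sum>i\<in>I. \<bar>X i \<omega>\<bar>)" using X by auto
  show "(\<lambda>\<omega>. MAX i\<in>I. X i \<omega>) \<in> borel_measurable M"
    using assms by (intro borel_measurable_Max borel_measurable_integrable) auto
  show "AE \<omega> in M. norm (MAX i\<in>I. X i \<omega>) \<le> norm (\<Sum>i\<in>I. \<bar>X i \<omega>\<bar>)"
  proof (rule AE_I2)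
    fix \<omega>
    have "(MAX i\<in>I. X i \<omega>) \<in> (\<lambda>i. X i \<omega>) ` I"
      using assms by (intro Max_in) auto
    then obtain i where "i \<in> I" "(MAX i\<in>I. X i \<omega>) = X i \<omega>" by auto
    then show "norm (MAX i\<in>I. X i \<omega>) \<le> norm (\<Sum>i\<in>I. \<bar>X i \<omega>\<bar>)"
      using member_le_sum[of i I "\<lambda>i. \<bar>X i \<omega>\<bar>"] assms by simp
  qed
qed

text \<open>For any level \<open>c\<close>, the maximum is at most \<open>c\<close> plus the sum of
  all excesses over \<open>c\<close>, and one excess has mean
  \<open>exp (- \<theta> * c) / \<theta>\<close>.\<close>

lemma (in prob_space) expectation_Max_exponential_le:
  assumes "n \<ge> 1" "\<theta> > 0"
    and D: "\<And>i. i \<in> {1..n} \<Longrightarrow> distributed M lborel (X i) (exponential_density \<theta>)"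
  shows "OPT M n X \<le> (ln (real n) + 1) / \<theta>"
proof -
  \<comment> \<open>The level that one reward exceeds with probability \<open>1 / n\<close>, so that
    the \<open>n\<close> mean excesses add up to \<open>1 / \<theta>\<close>.\<close>
  define c where "c = ln (real n) / \<theta>"
  have c: "c \<ge> 0" "exp (- \<theta> * c) = 1 / real n"
    using assms by (auto simp: c_def exp_minus field_simps)
  have X: "integrable M (X i)" if "i \<in> {1..n}" for i
    using erlang_ith_moment_integrable[OF \<open>\<theta> > 0\<close> D[OF that], of 1] by simp
  have int: "integrable M (\<lambda>\<omega>. max (X i \<omega>) c - c)" if "i \<in> {1..n}" for i
    using X[OF that] by (intro Bochner_Integration.integrable_diff integrable_max) auto
  have excess: "expectation (\<lambda>\<omega>. max (X i \<omega>) c - c) = 1 / (n * \<theta>)" if "i \<in> {1..n}" for i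
  proof -
    have "expectation (\<lambda>\<omega>. max (X i \<omega>) c - c) = expectation (\<lambda>\<omega>. if c \<le> X i \<omega> then X i \<omega> else c) - c"
      using X[OF that] by (simp add: prob_space max.commute[of _ c] flip: max_def)
    also have "\<dots> = 1 / (n * \<theta>)"
      using exponential_distributed_truncated_expectation[OF D[OF that] \<open>\<theta> > 0\<close> c(1), of c] c(2)
      by (simp add: field_simps)
    finally show ?thesis .
  qed
  have "OPT M n X \<le> expectation (\<lambda>\<omega>. c + (\<Sum>i\<in>{1..n}. max (X i \<omega>) c - c))"
    unfolding OPT_def
  proof (rule integral_mono)
    show "integrable M (\<lambda>\<omega>. MAX t\<in>{1..n}. X t \<omega>)"
      using assms X by (intro integrable_Max) auto
    show "integrable M (\<lambda>\<omega>. c + (\<Sum>i\<in>{1..n}. max (X i \<omega>) c - c))"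
      by (intro Bochner_Integration.integrable_add Bochner_Integration.integrable_sum int) auto
    fix \<omega>
    show "(MAX t\<in>{1..n}. X t \<omega>) \<le> c + (\<Sum>i\<in>{1..n}. max (X i \<omega>) c - c)"
    proof (subst Max_le_iff, safe)
      fix i assume "i \<in> {1..n}"
      then have "max (X i \<omega>) c - c \<le> (\<Sum>i\<in>{1..n}. max (X i \<omega>) c - c)"
        by (intro member_le_sum) auto
      then show "X i \<omega> \<le> c + (\<Sum>i\<in>{1..n}. max (X i \<omega>) c - c)" by linarith
    qed (use assms in auto)
  qed
  also have "\<dots> = c + (\<Sum>i\<in>{1..n}. expectation (\<lambda>\<omega>. max (X i \<omega>) c - c))"
    using int by (subst Bochner_Integration.integral_add) (auto simp: prob_space
      intro!: Bochner_Integration.integral_sum)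
  also have "\<dots> = (ln (real n) + 1) / \<theta>"
    using assms by (simp add: excess) (simp add: c_def field_simps)
  finally show ?thesis .
qed

lemma (in prob_space) OPT_exponential_pos:
  assumes "n \<ge> 1" "\<theta> > 0"
    and D: "\<And>i. i \<in> {1..n} \<Longrightarrow> distributed M lborel (X i) (exponential_density \<theta>)"
  shows "OPT M n X > 0"
proof -
  have X: "integrable M (X i)" if "i \<in> {1..n}" for i
    using erlang_ith_moment_integrable[OF \<open>\<theta> > 0\<close> D[OF that], of 1] by simp
  have "0 < 1 / \<theta>" using \<open>\<theta> > 0\<close> by simp
  also have "\<dots> = expectation (X 1)"
    using exponential_distributed_expectation[OF \<open>\<theta> > 0\<close> D[of 1]] assms by simp
  also have "\<dots> \<le> OPT M n X"
    unfolding OPT_def using assms X by (intro integral_mono integrable_Max Max_ge) auto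
  finally show ?thesis .
qed

section \<open>Growth and stability of the dynamic program\<close>

text \<open>The rate is a pure scale parameter, so an estimated threshold differs from the true one
  by the ratio of the rates. For rate 0, division by zero makes both sides vanish.\<close>

lemma dp_back_rescale: "dp_back \<theta> k = dp_back 1 k / \<theta>"
proof (cases "\<theta> = 0")
  case True
  then show ?thesis by (induction k) auto
next
  case False
  then show ?thesis by (induction k) (simp_all add: add_divide_distrib)
qed

text \<open>For \<open>w = exp (dp_back 1 k)\<close> the recursion turns \<open>w\<close> into
  \<open>w * exp (1 / w)\<close>, which is at least \<open>w + 1\<close>.\<close>

lemma exp_dp_back_lower: "real k + 1 \<le> exp (dp_back 1 k)"
proof (induction k)
  case (Suc k)
  have "exp (dp_back 1 k) + 1 = exp (dp_back 1 k) * (1 + exp (- dp_back 1 k))"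
    by (simp add: distrib_left exp_minus_inverse)
  also have "\<dots> \<le> exp (dp_back 1 k) * exp (exp (- dp_back 1 k))"
    by (intro mult_left_mono exp_ge_add_one_self) auto
  finally show ?case
    using Suc by (simp add: exp_add)
qed auto

text \<open>With \<open>u = 1 / w \<le> 1\<close>, the quadratic bound on \<open>exp u\<close> shows
  that one step adds at most \<open>1 + u \<le> 2\<close>. The constant 3 covers the start
  \<open>exp 1\<close>.\<close>

lemma exp_dp_back_upper: "exp (dp_back 1 k) \<le> 2 * real k + 3"
proof (induction k)
  case 0
  then show ?case using exp_le by simp
next
  case (Suc k)
  define u where "u = exp (- dp_back 1 k)"
  have "1 \<le> exp (dp_back 1 k)" using exp_dp_back_lower[of k] by linarith
  then have u: "0 < u" "u \<le> 1" "exp (dp_back 1 k) * u = 1"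
    by (simp_all add: u_def exp_minus_inverse)
  have "exp (dp_back 1 (Suc k)) = exp (dp_back 1 k) * exp u"
    by (simp add: u_def exp_add)
  also have "\<dots> \<le> exp (dp_back 1 k) * (1 + u + u\<^sup>2)"
    using u by (intro mult_left_mono exp_bound) auto
  also have "\<dots> = exp (dp_back 1 k) + exp (dp_back 1 k) * u + exp (dp_back 1 k) * u * u"
    by (simp add: distrib_left power2_eq_square)
  also have "\<dots> = exp (dp_back 1 k) + 1 + u"
    unfolding u(3) by simp
  finally show ?case using Suc u by simp
qed

lemma dp_back_lower: "ln (real k + 1) \<le> dp_back 1 k"
  using ln_mono[OF exp_dp_back_lower[of k]] by simp

lemma dp_back_upper: "dp_back 1 k \<le> ln (2 * real k + 3)"
  by (subst ln_ge_iff) (use exp_dp_back_upper[of k] in auto)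

text \<open>A threshold \<open>a\<close> off the optimal one by \<open>1 / (2\<theta>)\<close> loses at most
  a constant factor in the acceptance probability. Hence the additive gap \<open>2 / \<theta>\<close> to the optimal
  value does not grow from one period to the next.\<close>
lemma dp_back_gap_step:
  assumes "\<theta> > 0" and close: "\<bar>\<theta> * a - dp_back 1 k\<bar> \<le> 1 / 2"
  shows "(dp_back 1 (Suc k) - 2) / \<theta>
    \<le> exp (- \<theta> * a) * (a + 1 / \<theta>) + (1 - exp (- \<theta> * a)) * ((dp_back 1 k - 2) / \<theta>)"
proof -
  define v b where "v = dp_back 1 k" and "b = \<theta> * a"
  have b: "\<bar>b - v\<bar> \<le> 1 / 2" using close by (simp add: v_def b_def)
  have "exp (1 / 2 :: real) \<le> 2"
    using exp_bound[of "1 / 2"] by (simp add: power2_eq_square)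
  moreover have "exp (b - v) \<le> exp (1 / 2)" using b by (intro exp_mono) linarith
  \<comment> \<open>Here the tolerance 1/2 and the gap 2 fit together: the left side is at most 2,
    the right side at least 5/2.\<close>
  ultimately have "exp (b - v) \<le> b + 3 - v" using b by linarith
  then have "exp (- b) * exp (b - v) \<le> exp (- b) * (b + 3 - v)" by (intro mult_left_mono) auto
  also have "exp (- b) * exp (b - v) = exp (- v)"
    by (simp flip: exp_add)
  finally have "v + exp (- v) - 2 \<le> exp (- b) * (b + 1) + (1 - exp (- b)) * (v - 2)"
    by (simp add: algebra_simps)
  then have "(v + exp (- v) - 2) / \<theta> \<le> (exp (- b) * (b + 1) + (1 - exp (- b)) * (v - 2)) / \<theta>"
    using \<open>\<theta> > 0\<close> by (intro divide_right_mono) auto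
  also have "\<dots> = exp (- b) * (a + 1 / \<theta>) + (1 - exp (- b)) * ((v - 2) / \<theta>)"
    using \<open>\<theta> > 0\<close> by (simp add: b_def field_simps)
  finally show ?thesis by (simp add: v_def b_def)
qed

section \<open>Adaptedness and measurability of the policy\<close>

lemma theta_U_cong: "(\<And>i. i \<in> {1..m} \<Longrightarrow> x i = y i) \<Longrightarrow> theta_U m \<delta> x = theta_U m \<delta> y"
  by (simp add: theta_U_def theta_hat_def)

text \<open>The decision in period \<open>t\<close> looks no further than time \<open>m + t\<close>.
  This allows the rewards to be replaced by their restriction to the past.\<close>

lemma cdp_accepts_cong:
  assumes "\<And>i. i \<in> {1..m + t} \<Longrightarrow> x i = y i"
  shows "cdp_accepts n m \<delta> x t \<longleftrightarrow> cdp_accepts n m \<delta> y t"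
  using assms theta_U_cong[of m x y \<delta>] by (auto simp: cdp_accepts_def)

lemma cdp_ol_eq:
  assumes "cdp_accepts n m \<delta> x t" "\<And>s. s \<in> {1..<t} \<Longrightarrow> \<not> cdp_accepts n m \<delta> x s"
  shows "cdp_ol n m \<delta> x = m + t"
proof -
  have "(LEAST t. cdp_accepts n m \<delta> x t) = t"
    using assms by (intro Least_equality) (auto simp: not_less cdp_accepts_def intro: leI)
  then show ?thesis using assms(1) by (auto simp: cdp_ol_def)
qed

lemma cdp_ol_range:
  assumes "m < n" shows "cdp_ol n m \<delta> x \<in> {1..n}"
proof (cases "\<exists>t. cdp_accepts n m \<delta> x t")
  case True
  then have "cdp_accepts n m \<delta> x (LEAST t. cdp_accepts n m \<delta> x t)" by (rule LeastI_ex)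
  then have "(LEAST t. cdp_accepts n m \<delta> x t) \<in> {1..n - m - 1}" by (simp add: cdp_accepts_def)
  then show ?thesis using True assms by (auto simp: cdp_ol_def)
qed (use assms in \<open>auto simp: cdp_ol_def\<close>)

text \<open>The sequence enters through a map \<open>Z\<close>, so that the same lemma serves
  histories in a product space and rewards on the sample space.\<close>

lemma theta_U_measurable:
  assumes [measurable]: "\<And>i. i \<in> {1..m} \<Longrightarrow> (\<lambda>h. Z h i) \<in> borel_measurable S"
  shows "(\<lambda>h. theta_U m \<delta> (Z h)) \<in> borel_measurable S"
  unfolding theta_U_def theta_hat_def by measurable

lemma dp_back_measurable [measurable (raw)]:
  assumes "f \<in> borel_measurable S"
  shows "(\<lambda>h. dp_back (f h) k) \<in> borel_measurable S"
proof -
  have "(\<lambda>h. dp_back 1 k / f h) \<in> borel_measurable S"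
    using assms by measurable
  then show ?thesis by (simp add: dp_back_rescale[of "f _"])
qed

lemma cdp_accepts_measurable:
  assumes Z: "\<And>i. i \<in> {1..m + t} \<Longrightarrow> (\<lambda>h. Z h i) \<in> borel_measurable S"
  shows "Measurable.pred S (\<lambda>h. cdp_accepts n m \<delta> (Z h) t)"
proof (cases "t \<in> {1..n - m - 1}")
  case True
  have [measurable]: "(\<lambda>h. theta_U m \<delta> (Z h)) \<in> borel_measurable S"
    using Z by (intro theta_U_measurable) auto
  have [measurable]: "(\<lambda>h. Z h (m + t)) \<in> borel_measurable S"
    using True by (intro Z) auto
  have "Measurable.pred S (\<lambda>h. dp_back (theta_U m \<delta> (Z h)) (n - m - (t + 1)) \<le> Z h (m + t))"
    by measurable
  then show ?thesis using True by (simp only: cdp_accepts_def dp_value_def simp_thms)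
next
  case False
  then have "\<not> cdp_accepts n m \<delta> (Z h) t" for h by (simp only: cdp_accepts_def simp_thms)
  then show ?thesis by simp
qed

text \<open>The good event, decided by the exploration phase alone. Period \<open>t\<close> uses the
  threshold with index \<open>k = n - m - (t + 1)\<close>, and \<open>t\<close> runs from 1 to
  \<open>n - m - 1\<close>; hence the range of \<open>k\<close>.\<close>

definition thresholds_close :: "real \<Rightarrow> nat \<Rightarrow> nat \<Rightarrow> real \<Rightarrow> (nat \<Rightarrow> real) \<Rightarrow> bool" where
  "thresholds_close \<theta> n m \<delta> x \<longleftrightarrow> 0 < theta_U m \<delta> x \<and>
     (\<forall>k\<in>{..<n - m - 1}. \<bar>\<theta> * dp_back (theta_U m \<delta> x) k - dp_back 1 k\<bar> \<le> 1 / 2)"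

text \<open>The good event is built in, so that the backward induction works on a single event for
  each period.\<close>

definition unstopped :: "real \<Rightarrow> nat \<Rightarrow> nat \<Rightarrow> real \<Rightarrow> nat \<Rightarrow> (nat \<Rightarrow> real) \<Rightarrow> bool" where
  "unstopped \<theta> n m \<delta> t x \<longleftrightarrow> thresholds_close \<theta> n m \<delta> x \<and> (\<forall>s\<in>{1..<t}. \<not> cdp_accepts n m \<delta> x s)"

lemma unstopped_Suc:
  "t \<ge> 1 \<Longrightarrow> unstopped \<theta> n m \<delta> (Suc t) x \<longleftrightarrow> unstopped \<theta> n m \<delta> t x \<and> \<not> cdp_accepts n m \<delta> x t"
  by (auto simp: unstopped_def less_Suc_eq)

text \<open>The bound \<open>m + t\<close> is strict, which makes the event independent of the next
  reward \<open>X (m + t)\<close>. Since \<open>t \<ge> 1\<close>, the whole exploration sample lies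
  before that time.\<close>

lemma unstopped_cong:
  assumes "t \<ge> 1" "\<And>i. i \<in> {1..<m + t} \<Longrightarrow> x i = y i"
  shows "unstopped \<theta> n m \<delta> t x \<longleftrightarrow> unstopped \<theta> n m \<delta> t y"
proof -
  have "theta_U m \<delta> x = theta_U m \<delta> y"
    using assms by (intro theta_U_cong) auto
  moreover have "cdp_accepts n m \<delta> x s \<longleftrightarrow> cdp_accepts n m \<delta> y s" if "s \<in> {1..<t}" for s
    using that assms by (intro cdp_accepts_cong) auto
  ultimately show ?thesis by (auto simp: unstopped_def thresholds_close_def)
qed

lemma unstopped_measurable:
  assumes "t \<ge> 1" and Z: "\<And>i. i \<in> {1..<m + t} \<Longrightarrow> (\<lambda>h. Z h i) \<in> borel_measurable S"
  shows "Measurable.pred S (\<lambda>h. unstopped \<theta> n m \<delta> t (Z h))"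
proof -
  have [measurable]: "(\<lambda>h. theta_U m \<delta> (Z h)) \<in> borel_measurable S"
    using assms by (intro theta_U_measurable) auto
  have "Measurable.pred S (\<lambda>h. \<forall>s\<in>{1..<t}. \<not> cdp_accepts n m \<delta> (Z h) s)"
    using assms by (intro pred_intros_finite(3) pred_intros_logic(2) cdp_accepts_measurable) auto
  moreover have "Measurable.pred S (\<lambda>h. thresholds_close \<theta> n m \<delta> (Z h))"
    unfolding thresholds_close_def by measurable
  ultimately show ?thesis
    unfolding unstopped_def by (rule pred_intros_logic(3)[rotated])
qed

section \<open>Backward induction for the reward of the policy\<close>

locale iid_exponential = prob_space M for M :: "'a measure" +
  fixes X :: "nat \<Rightarrow> 'a \<Rightarrow> real" and n m :: nat and \<theta> \<delta> :: real
  assumes indep: "indep_vars (\<lambda>_. borel) X {1..n}"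
    and exponential: "i \<in> {1..n} \<Longrightarrow> distributed M lborel (X i) (exponential_density \<theta>)"
    and rate_pos: "\<theta> > 0"
    and explore_less: "m < n"
begin

abbreviation "rewards \<omega> \<equiv> \<lambda>i. X i \<omega>"
abbreviation "stop \<omega> \<equiv> cdp_ol n m \<delta> (rewards \<omega>)"
abbreviation "alive t \<omega> \<equiv> unstopped \<theta> n m \<delta> t (rewards \<omega>)"

lemma reward_measurable: "i \<in> {1..n} \<Longrightarrow> X i \<in> borel_measurable M"
  using distributed_measurable[OF exponential] by auto

lemma reward_integrable: "i \<in> {1..n} \<Longrightarrow> integrable M (X i)"
  using erlang_ith_moment_integrable[OF rate_pos exponential, of i 1] by simp

lemma reward_nonneg: "i \<in> {1..n} \<Longrightarrow> AE \<omega> in M. 0 \<le> X i \<omega>"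
  by (subst distributed_AE2[OF exponential]) (auto simp: exponential_density_def)

lemma alive_measurable:
  assumes "t \<in> {1..n - m}" shows "Measurable.pred M (alive t)"
  using assms by (intro unstopped_measurable reward_measurable) auto

lemma stop_measurable: "stop \<in> measurable M (count_space UNIV)"
proof -
  have acc: "Measurable.pred M (\<lambda>\<omega>. cdp_accepts n m \<delta> (rewards \<omega>) t)" for t
  proof (cases "t \<in> {1..n - m - 1}")
    case True
    then show ?thesis by (intro cdp_accepts_measurable reward_measurable) auto
  next
    case False
    then have "\<not> cdp_accepts n m \<delta> (rewards \<omega>) t" for \<omega> by (auto simp: cdp_accepts_def)
    then show ?thesis by simp
  qed
  have "(\<lambda>\<omega>. m + (LEAST t. cdp_accepts n m \<delta> (rewards \<omega>) t)) \<in> measurable M (count_space UNIV)"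
    by (rule measurable_compose[OF measurable_Least[OF acc]]) simp
  moreover have "Measurable.pred M (\<lambda>\<omega>. \<exists>t. cdp_accepts n m \<delta> (rewards \<omega>) t)"
    by (intro pred_intros_countable(2) acc)
  ultimately show ?thesis
    unfolding cdp_ol_def by (intro measurable_If) (auto simp: pred_def)
qed

text \<open>The policy always stops within \<open>{1..n}\<close>, so the reward at a random index
  becomes a finite sum of rewards cut down to events.\<close>

lemma stopped_eq_sum: "X (stop \<omega>) \<omega> = (\<Sum>i=1..n. of_bool (stop \<omega> = i) * X i \<omega>)"
proof -
  have "(\<Sum>i=1..n. of_bool (stop \<omega> = i) * X i \<omega>) = (\<Sum>i=1..n. if stop \<omega> = i then X i \<omega> else 0)"
    by (intro sum.cong) auto
  also have "\<dots> = X (stop \<omega>) \<omega>"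
    using cdp_ol_range[OF explore_less, of \<delta> "rewards \<omega>"] by (subst sum.delta') auto
  finally show ?thesis by simp
qed

lemma stopped_integrable: "integrable M (\<lambda>\<omega>. X (stop \<omega>) \<omega>)"
proof -
  note [measurable] = stop_measurable
  have "integrable M (\<lambda>\<omega>. X i \<omega> * indicator {\<omega> \<in> space M. stop \<omega> = i} \<omega>)" if "i \<in> {1..n}" for i
    using reward_integrable[OF that] by (intro integrable_real_mult_indicator) auto
  then have "integrable M (\<lambda>\<omega>. \<Sum>i=1..n. X i \<omega> * indicator {\<omega> \<in> space M. stop \<omega> = i} \<omega>)"
    by (intro Bochner_Integration.integrable_sum)
  also have "(\<lambda>\<omega>. \<Sum>i=1..n. X i \<omega> * indicator {\<omega> \<in> space M. stop \<omega> = i} \<omega>) =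
      (\<lambda>\<omega>. X (stop \<omega>) \<omega> * indicator (space M) \<omega>)"
    by (subst stopped_eq_sum) (auto simp: fun_eq_iff sum_distrib_right intro!: sum.cong split: split_indicator)
  finally show ?thesis
    by (rule Bochner_Integration.integrable_cong[THEN iffD1, OF refl, rotated]) simp
qed

lemma stopped_integrable_on:
  assumes [measurable]: "Measurable.pred M Q"
  shows "integrable M (\<lambda>\<omega>. of_bool (Q \<omega>) * X (stop \<omega>) \<omega>)"
  by (rule Bochner_Integration.integrable_bound[OF stopped_integrable])
     (use borel_measurable_integrable[OF stopped_integrable] in auto)

lemma stopped_nonneg: "AE \<omega> in M. 0 \<le> X (stop \<omega>) \<omega>"
proof -
  have "AE \<omega> in M. \<forall>i\<in>{1..n}. 0 \<le> X i \<omega>"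
    by (intro AE_finite_allI reward_nonneg) auto
  then show ?thesis
    using cdp_ol_range[OF explore_less] by (auto elim!: AE_mp)
qed

lemma stop_last: "alive (n - m) \<omega> \<Longrightarrow> stop \<omega> = n"
  by (force simp: unstopped_def cdp_ol_def cdp_accepts_def)

text \<open>This is \<open>threshold_step_bound\<close> with all rewards before time
  \<open>m + t\<close> as the past. The conditions on \<open>a\<close> concern only histories with
  close thresholds, as \<open>alive t\<close> includes that event.\<close>

lemma alive_threshold_step:
  assumes t: "t \<in> {1..n - m}"
    and a_meas: "a \<in> borel_measurable (\<Pi>\<^sub>M i\<in>{1..<m + t}. borel)"
    and a: "\<And>h. thresholds_close \<theta> n m \<delta> h \<Longrightarrow> 0 \<le> a h"
    and l: "\<And>h. thresholds_close \<theta> n m \<delta> h \<Longrightarrow>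
      l \<le> exp (- \<theta> * a h) * (a h + 1 / \<theta>) + (1 - exp (- \<theta> * a h)) * c"
    and a_cong: "\<And>\<omega>. a (restrict (rewards \<omega>) {1..<m + t}) = a (rewards \<omega>)"
  shows "l * prob {\<omega> \<in> space M. alive t \<omega>}
    \<le> expectation (\<lambda>\<omega>. of_bool (alive t \<omega>) *
        (if a (rewards \<omega>) \<le> X (m + t) \<omega> then X (m + t) \<omega> else c))"
proof -
  let ?J = "{1..<m + t}"
  have r: "unstopped \<theta> n m \<delta> t (restrict (rewards \<omega>) ?J) \<longleftrightarrow> alive t \<omega>" for \<omega>
    using t by (intro unstopped_cong) auto
  have "Measurable.pred (\<Pi>\<^sub>M i\<in>?J. borel) (\<lambda>h. unstopped \<theta> n m \<delta> t h)"
    using t by (intro unstopped_measurable) auto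
  then have "l * prob {\<omega> \<in> space M. unstopped \<theta> n m \<delta> t (restrict (rewards \<omega>) ?J)}
    \<le> expectation (\<lambda>\<omega>. of_bool (unstopped \<theta> n m \<delta> t (restrict (rewards \<omega>) ?J)) *
        (if a (restrict (rewards \<omega>) ?J) \<le> X (m + t) \<omega> then X (m + t) \<omega> else c))"
    using t a l a_meas by (intro threshold_step_bound[OF indep]) (auto simp: unstopped_def intro: exponential rate_pos)
  then show ?thesis unfolding r a_cong .
qed

text \<open>Induction on \<open>t\<close> downwards from the last period. Rejection in period
  \<open>t\<close> leads to \<open>alive (Suc t)\<close>, where the induction hypothesis supplies
  the continuation value, and \<open>dp_back_gap_step\<close> keeps the gap at 2.\<close>

lemma alive_reward_bound:
  assumes "t \<in> {1..n - m}"
  shows "(dp_back 1 (n - m - t) - 2) / \<theta> * prob {\<omega> \<in> space M. alive t \<omega>}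
    \<le> expectation (\<lambda>\<omega>. of_bool (alive t \<omega>) * X (stop \<omega>) \<omega>)"
proof -
  have "t \<le> n - m" "1 \<le> t" using assms by auto
  then show ?thesis
  proof (induction rule: inc_induct)
    case base
    have n: "m + (n - m) = n" "n \<in> {1..n}" using explore_less by auto
    \<comment> \<open>The forced acceptance at time \<open>n\<close> is treated as a decision with
      threshold 0 and continuation value 0; rewards are almost surely nonnegative.\<close>
    have "(dp_back 1 0 - 2) / \<theta> * prob {\<omega> \<in> space M. alive (n - m) \<omega>}
      \<le> expectation (\<lambda>\<omega>. of_bool (alive (n - m) \<omega>) *
        (if 0 \<le> X (m + (n - m)) \<omega> then X (m + (n - m)) \<omega> else 0))"
      using explore_less rate_pos by (intro alive_threshold_step) (auto simp: field_simps)
    also have "\<dots> = expectation (\<lambda>\<omega>. of_bool (alive (n - m) \<omega>) * X (stop \<omega>) \<omega>)"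
    proof (rule integral_cong_AE)
      show "AE \<omega> in M. of_bool (alive (n - m) \<omega>) * (if 0 \<le> X (m + (n - m)) \<omega> then X (m + (n - m)) \<omega> else 0)
          = of_bool (alive (n - m) \<omega>) * X (stop \<omega>) \<omega>"
        using reward_nonneg[OF n(2)] by eventually_elim (use n stop_last in auto)
      show "(\<lambda>\<omega>. of_bool (alive (n - m) \<omega>) * X (stop \<omega>) \<omega>) \<in> borel_measurable M"
        using explore_less by (intro borel_measurable_integrable stopped_integrable_on alive_measurable) auto
      have [measurable]: "X n \<in> borel_measurable M" "Measurable.pred M (alive (n - m))"
        using explore_less by (auto intro!: reward_measurable alive_measurable)
      show "(\<lambda>\<omega>. of_bool (alive (n - m) \<omega>) * (if 0 \<le> X (m + (n - m)) \<omega> then X (m + (n - m)) \<omega> else 0))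
          \<in> borel_measurable M"
        unfolding n by measurable
    qed
    finally show ?case by simp
  next
    case (step t)
    then have t: "t \<in> {1..n - m}" "t \<in> {1..n - m - 1}" "Suc t \<in> {1..n - m}" "m + t \<in> {1..n}" by auto
    \<comment> \<open>The index of the threshold used in period \<open>t\<close>; the value on
      entering that period has index \<open>Suc k\<close>.\<close>
    define k where "k = n - m - Suc t"
    have k: "n - m - t = Suc k" "k \<in> {..<n - m - 1}" using step by (auto simp: k_def)
    define c where "c = (dp_back 1 k - 2) / \<theta>"
    define a where "a = (\<lambda>h. dp_back (theta_U m \<delta> h) k)"
    have acc: "cdp_accepts n m \<delta> x t \<longleftrightarrow> a x \<le> x (m + t)" for x
      using t by (simp add: cdp_accepts_def dp_value_def a_def k_def)
    note [measurable] = alive_measurable[OF t(1)] alive_measurable[OF t(3)] reward_measurable[OF t(4)]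
    have "(dp_back 1 (Suc k) - 2) / \<theta> * prob {\<omega> \<in> space M. alive t \<omega>}
      \<le> expectation (\<lambda>\<omega>. of_bool (alive t \<omega>) *
          (if a (rewards \<omega>) \<le> X (m + t) \<omega> then X (m + t) \<omega> else c))"
    proof (rule alive_threshold_step[OF t(1)])
      have [measurable]: "(\<lambda>h. theta_U m \<delta> h) \<in> borel_measurable (\<Pi>\<^sub>M i\<in>{1..<m + t}. borel)"
        using t by (intro theta_U_measurable) auto
      show "a \<in> borel_measurable (\<Pi>\<^sub>M i\<in>{1..<m + t}. borel)"
        unfolding a_def by measurable
      show "a (restrict (rewards \<omega>) {1..<m + t}) = a (rewards \<omega>)" for \<omega>
        unfolding a_def using t by (intro arg_cong2[where f=dp_back] theta_U_cong) auto
      fix h assume h: "thresholds_close \<theta> n m \<delta> h"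
      have "0 \<le> dp_back 1 k" using dp_back_lower[of k] by (smt (verit) ln_ge_zero of_nat_0_le_iff)
      then show "0 \<le> a h" using h unfolding a_def by (subst dp_back_rescale) (auto simp: thresholds_close_def)
      show "(dp_back 1 (Suc k) - 2) / \<theta> \<le> exp (- \<theta> * a h) * (a h + 1 / \<theta>) + (1 - exp (- \<theta> * a h)) * c"
        unfolding c_def by (rule dp_back_gap_step[OF rate_pos]) (use h k in \<open>auto simp: thresholds_close_def a_def\<close>)
    qed
    \<comment> \<open>Split by the decision in period \<open>t\<close>: on acceptance the policy
      collects its reward there, on rejection the constant \<open>c\<close> stands in for what
      follows.\<close>
    also have "\<dots> = expectation (\<lambda>\<omega>. of_bool (alive t \<omega> \<and> \<not> alive (Suc t) \<omega>) * X (stop \<omega>) \<omega>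
        + c * indicator {\<omega> \<in> space M. alive (Suc t) \<omega>} \<omega>)"
    proof (intro Bochner_Integration.integral_cong refl)
      fix \<omega> assume "\<omega> \<in> space M"
      moreover have "stop \<omega> = m + t" if "alive t \<omega>" "a (rewards \<omega>) \<le> X (m + t) \<omega>"
        using that by (intro cdp_ol_eq) (auto simp: unstopped_def acc)
      ultimately show "of_bool (alive t \<omega>) * (if a (rewards \<omega>) \<le> X (m + t) \<omega> then X (m + t) \<omega> else c)
        = of_bool (alive t \<omega> \<and> \<not> alive (Suc t) \<omega>) * X (stop \<omega>) \<omega>
          + c * indicator {\<omega> \<in> space M. alive (Suc t) \<omega>} \<omega>"
        using t by (auto simp: unstopped_Suc acc)
    qed
    also have "\<dots> = expectation (\<lambda>\<omega>. of_bool (alive t \<omega> \<and> \<not> alive (Suc t) \<omega>) * X (stop \<omega>) \<omega>)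
        + c * prob {\<omega> \<in> space M. alive (Suc t) \<omega>}"
      by (subst Bochner_Integration.integral_add)
         (auto intro!: stopped_integrable_on integrable_mult_right simp: emeasure_eq_measure)
    \<comment> \<open>The induction hypothesis replaces the constant by the reward really collected
      after period \<open>t\<close>.\<close>
    also have "\<dots> \<le> expectation (\<lambda>\<omega>. of_bool (alive t \<omega> \<and> \<not> alive (Suc t) \<omega>) * X (stop \<omega>) \<omega>)
        + expectation (\<lambda>\<omega>. of_bool (alive (Suc t) \<omega>) * X (stop \<omega>) \<omega>)"
      using step.IH by (simp add: c_def k_def)
    also have "\<dots> = expectation (\<lambda>\<omega>. of_bool (alive t \<omega> \<and> \<not> alive (Suc t) \<omega>) * X (stop \<omega>) \<omega>
        + of_bool (alive (Suc t) \<omega>) * X (stop \<omega>) \<omega>)"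
      by (intro Bochner_Integration.integral_add[symmetric] stopped_integrable_on) measurable
    also have "\<dots> = expectation (\<lambda>\<omega>. of_bool (alive t \<omega>) * X (stop \<omega>) \<omega>)"
      using t by (intro Bochner_Integration.integral_cong) (auto simp: unstopped_Suc)
    finally show ?case unfolding k(1) .
  qed
qed

text \<open>\<open>alive 1\<close> is just the good event. Outside it, nonnegativity of the rewards
  is enough.\<close>

lemma stopped_reward_bound:
  "(dp_back 1 (n - m - 1) - 2) / \<theta> * prob {\<omega> \<in> space M. thresholds_close \<theta> n m \<delta> (rewards \<omega>)}
    \<le> expectation (\<lambda>\<omega>. X (stop \<omega>) \<omega>)"
proof -
  have 1: "1 \<in> {1..n - m}" using explore_less by auto
  have "(dp_back 1 (n - m - 1) - 2) / \<theta> * prob {\<omega> \<in> space M. alive 1 \<omega>}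
      \<le> expectation (\<lambda>\<omega>. of_bool (alive 1 \<omega>) * X (stop \<omega>) \<omega>)"
    by (rule alive_reward_bound[OF 1])
  also have "\<dots> \<le> expectation (\<lambda>\<omega>. X (stop \<omega>) \<omega>)"
    using stopped_nonneg
    by (intro integral_mono_AE stopped_integrable stopped_integrable_on alive_measurable 1)
       (auto elim!: eventually_mono)
  finally show ?thesis by (simp add: unstopped_def)
qed

end

section \<open>Accuracy of the upper confidence rate\<close>

text \<open>The ratio of the true to the estimated rate is \<open>q / (1 + e)\<close>. With
  \<open>L = ln (real n)\<close>, both \<open>q - 1\<close> and \<open>e\<close> are at most
  \<open>1 / (8 * L)\<close> in size, so the relative error is at most \<open>1 / (4 * L)\<close>,
  while the rate 1 thresholds are at most \<open>2 * L\<close>.\<close>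

lemma thresholds_closeI:
  assumes "0 < \<theta>" "0 < m" "n \<ge> 2" "ln (real n) \<ge> 1"
    and width: "0 \<le> conf_width m \<delta>" "conf_width m \<delta> \<le> 1 / (8 * ln (real n))"
    and mean: "\<bar>(\<Sum>i=1..m. x i) - real m / \<theta>\<bar> < real m / (8 * ln (real n) * \<theta>)"
  shows "thresholds_close \<theta> n m \<delta> x"
proof -
  \<comment> \<open>\<open>q\<close> is the sample mean divided by the true mean
    \<open>1 / \<theta>\<close>.\<close>
  define L e S q where "L = ln (real n)" and "e = conf_width m \<delta>" and "S = (\<Sum>i=1..m. x i)"
    and "q = \<theta> * S / real m"
  have L: "L \<ge> 1" using assms by (simp add: L_def)
  have "\<bar>q - 1\<bar> = (\<theta> / real m) * \<bar>S - real m / \<theta>\<bar>"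
    using assms by (simp add: q_def abs_mult_pos' field_simps flip: abs_mult_pos)
  also have "\<dots> \<le> (\<theta> / real m) * (real m / (8 * L * \<theta>))"
    using mean assms by (intro mult_left_mono) (auto simp: S_def L_def)
  also have "\<dots> = 1 / (8 * L)" using assms by (simp add: field_simps)
  finally have q: "\<bar>q - 1\<bar> \<le> 1 / (8 * L)" .
  moreover have "1 / (8 * L) \<le> 1 / 8" using L by (simp add: field_simps)
  ultimately have "q > 0" by linarith
  then have "S > 0" using assms by (simp add: q_def zero_less_divide_iff zero_less_mult_iff)
  have U: "theta_U m \<delta> x = (1 + e) * (real m / S)"
    by (simp add: theta_U_def theta_hat_def e_def S_def)
  have "e \<ge> 0" "e \<le> 1 / (8 * L)" using width by (auto simp: e_def L_def)
  have "\<bar>\<theta> * dp_back (theta_U m \<delta> x) k - dp_back 1 k\<bar> \<le> 1 / 2" if "k < n - m - 1" for k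
  proof -
    define v where "v = dp_back 1 k"
    have "v \<ge> 0" using dp_back_lower[of k] by (smt (verit) ln_ge_zero of_nat_0_le_iff v_def)
    \<comment> \<open>A crude bound through \<open>2 * n\<close>; squaring \<open>n\<close> only
      doubles the logarithm.\<close>
    have "2 * k + 3 \<le> n * n" using that assms by (intro order.trans[OF _ mult_le_mono1[of 2 n n]]) auto
    then have "2 * real k + 3 \<le> real n ^ 2"
      unfolding power2_eq_square by (simp flip: of_nat_mult of_nat_le_iff[where 'a=real])
    then have "ln (2 * real k + 3) \<le> ln (real n ^ 2)" by (intro ln_mono) auto
    then have "v \<le> 2 * L"
      using dp_back_upper[of k] assms by (simp add: v_def L_def ln_realpow)
    have "\<theta> * dp_back (theta_U m \<delta> x) k = v * (q / (1 + e))"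
      by (subst dp_back_rescale) (simp add: U q_def v_def mult_ac)
    moreover have "q / (1 + e) - 1 = (q - 1 - e) / (1 + e)"
      using \<open>e \<ge> 0\<close> by (simp add: field_simps)
    ultimately have "\<theta> * dp_back (theta_U m \<delta> x) k - v = v * ((q - 1 - e) / (1 + e))"
      by (metis mult.right_neutral right_diff_distrib)
    also have "\<bar>\<dots>\<bar> = v * (\<bar>q - 1 - e\<bar> / (1 + e))"
      using \<open>v \<ge> 0\<close> \<open>e \<ge> 0\<close> by (simp add: abs_mult)
    also have "\<dots> \<le> (2 * L) * (1 / (4 * L))"
    proof (intro mult_mono)
      have "\<bar>q - 1 - e\<bar> / (1 + e) \<le> \<bar>q - 1 - e\<bar> / 1"
        using \<open>e \<ge> 0\<close> by (intro divide_left_mono) auto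
      also have "\<dots> \<le> 1 / (8 * L) + 1 / (8 * L)"
        using q \<open>e \<ge> 0\<close> \<open>e \<le> 1 / (8 * L)\<close> by simp
      finally show "\<bar>q - 1 - e\<bar> / (1 + e) \<le> 1 / (4 * L)" by simp
    qed (use \<open>v \<le> 2 * L\<close> \<open>e \<ge> 0\<close> L in auto)
    also have "\<dots> = 1 / 2" using L by simp
    finally show ?thesis by (simp add: v_def)
  qed
  then show ?thesis
    using \<open>S > 0\<close> \<open>e \<ge> 0\<close> assms by (auto simp: thresholds_close_def U)
qed

context iid_exponential
begin

text \<open>Chebyshev for the sum of the exploration rewards, which has variance
  \<open>m / \<theta>\<^sup>2\<close>. A deviation of \<open>m / (8 * L * \<theta>)\<close> then has
  probability at most \<open>64 * L\<^sup>2 / m\<close>, and \<open>fail\<close> bounds this by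
  \<open>\<delta>\<close>.\<close>

lemma thresholds_close_prob:
  assumes m: "0 < m" and n: "n \<ge> 2" "ln (real n) \<ge> 1"
    and width: "0 \<le> conf_width m \<delta>" "conf_width m \<delta> \<le> 1 / (8 * ln (real n))"
    and fail: "64 * (ln (real n))\<^sup>2 / real m \<le> \<delta>"
  shows "1 - \<delta> \<le> prob {\<omega> \<in> space M. thresholds_close \<theta> n m \<delta> (rewards \<omega>)}"
proof -
  define L where "L = ln (real n)"
  have L: "L \<ge> 1" using n by (simp add: L_def)
  define S where "S = (\<lambda>\<omega>. \<Sum>i=1..m. X i \<omega>)"
  have sub: "{1..m} \<subseteq> {1..n}" using explore_less by auto
  \<comment> \<open>The Erlang shape is counted from 0: shape \<open>m - 1\<close> belongs to a sum
    of \<open>m\<close> exponentials.\<close>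
  have "distributed M lborel (\<lambda>\<omega>. \<Sum>i\<in>{1..m}. X i \<omega>) (erlang_density (card {1..m} - 1) \<theta>)"
    using m sub by (intro exponential_distributed_sum rate_pos exponential indep_vars_subset[OF indep sub]) auto
  then have D: "distributed M lborel S (erlang_density (m - 1) \<theta>)"
    by (simp add: S_def)
  have [measurable]: "random_variable borel S" using distributed_measurable[OF D] by simp
  have mean: "expectation S = real m / \<theta>"
    using erlang_ith_moment[OF rate_pos D, of 1] m by (cases m) simp_all
  have var: "variance S = real m / \<theta>\<^sup>2"
    using erlang_distributed_variance[OF rate_pos D] m by (simp add: of_nat_diff)
  define a where "a = real m / (8 * L * \<theta>)"
  have "a > 0" using m L rate_pos by (simp add: a_def)
  define B where "B = {\<omega> \<in> space M. \<bar>S \<omega> - real m / \<theta>\<bar> \<ge> a}"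
  have [measurable]: "B \<in> events" unfolding B_def by measurable
  have "prob B \<le> variance S / a\<^sup>2"
    using Chebyshev_inequality[of S a] erlang_ith_moment_integrable[OF rate_pos D, of 2] \<open>a > 0\<close>
    unfolding mean B_def by simp
  also have "\<dots> = 64 * L\<^sup>2 / real m"
    unfolding var a_def using m L rate_pos by (simp add: power2_eq_square field_simps)
  finally have "prob B \<le> \<delta>" using fail by (simp add: L_def)
  then have "1 - \<delta> \<le> prob (space M - B)" by (simp add: prob_compl)
  also have "\<dots> \<le> prob {\<omega> \<in> space M. thresholds_close \<theta> n m \<delta> (rewards \<omega>)}"
  proof (rule finite_measure_mono)
    show "space M - B \<subseteq> {\<omega> \<in> space M. thresholds_close \<theta> n m \<delta> (rewards \<omega>)}"
      using m n width rate_pos by (auto simp: B_def S_def a_def L_def not_le intro!: thresholds_closeI)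
    show "{\<omega> \<in> space M. thresholds_close \<theta> n m \<delta> (rewards \<omega>)} \<in> events"
      using alive_measurable[of 1] explore_less by (simp add: unstopped_def pred_def)
  qed
  finally show ?thesis .
qed

text \<open>The reward on the good event is at least \<open>(L - 3) / \<theta>\<close> and the
  expected maximum at most \<open>(L + 1) / \<theta>\<close>; the quotient is
  \<open>1 - 4 / (L + 1)\<close>. The assumption \<open>L \<ge> 3\<close> keeps the numerator
  nonnegative.\<close>

lemma CR_lower_bound:
  assumes m: "0 < m" "2 * m \<le> n" and n: "ln (real n) \<ge> 3" and "\<delta> < 1"
    and width: "0 \<le> conf_width m \<delta>" "conf_width m \<delta> \<le> 1 / (8 * ln (real n))"
    and fail: "64 * (ln (real n))\<^sup>2 / real m \<le> \<delta>"
  shows "(1 - \<delta>) * (1 - 4 / ln (real n)) \<le> CR M n X stop"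
proof -
  define L where "L = ln (real n)"
  have L: "L \<ge> 3" using n by (simp add: L_def)
  \<comment> \<open>At least half of the horizon remains, which costs \<open>ln 2 < 1\<close> in the
    value. Together with the gap 2 this makes the 3 in \<open>L - 3\<close>.\<close>
  have "ln (real n / 2) \<le> ln (real (n - m - 1) + 1)"
    using m by (intro ln_mono) auto
  also have "ln (real n / 2) = L - ln 2" using m by (simp add: L_def ln_div)
  finally have v: "L - 1 \<le> dp_back 1 (n - m - 1)"
    using dp_back_lower[of "n - m - 1"] ln_2_less_1 by linarith
  have OPT: "0 < OPT M n X" "OPT M n X \<le> (L + 1) / \<theta>"
    unfolding L_def using m rate_pos exponential
    by (auto intro!: OPT_exponential_pos expectation_Max_exponential_le)
  have "(1 - \<delta>) * ((L - 3) / \<theta>) \<le>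
      prob {\<omega> \<in> space M. thresholds_close \<theta> n m \<delta> (rewards \<omega>)} * ((dp_back 1 (n - m - 1) - 2) / \<theta>)"
    using m n width fail v rate_pos L \<open>\<delta> < 1\<close>
    by (intro mult_mono thresholds_close_prob divide_right_mono) auto
  also have "\<dots> \<le> expectation (\<lambda>\<omega>. X (stop \<omega>) \<omega>)"
    using stopped_reward_bound by (simp add: mult.commute)
  finally have E: "(1 - \<delta>) * ((L - 3) / \<theta>) \<le> expectation (\<lambda>\<omega>. X (stop \<omega>) \<omega>)" .
  have "1 - 4 / L \<le> 1 - 4 / (L + 1)"
    using L by (intro diff_left_mono divide_left_mono) auto
  also have "\<dots> = (L - 3) / (L + 1)" using L by (simp add: field_simps)
  finally have "(1 - \<delta>) * (1 - 4 / L) \<le> (1 - \<delta>) * ((L - 3) / (L + 1))"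
    using \<open>\<delta> < 1\<close> by (intro mult_left_mono) auto
  also have "\<dots> = (1 - \<delta>) * ((L - 3) / \<theta>) / ((L + 1) / \<theta>)"
    using rate_pos by simp
  also have "\<dots> \<le> expectation (\<lambda>\<omega>. X (stop \<omega>) \<omega>) / OPT M n X"
    using OPT L \<open>\<delta> < 1\<close> rate_pos E by (intro frac_le) (auto intro: order.trans[OF _ E])
  finally show ?thesis by (simp add: CR_def L_def)
qed

end

section \<open>Asymptotics in the horizon\<close>

text \<open>The quantifier order makes the constants absolute. The horizon from which the bound
  holds may depend on \<open>\<delta>\<close>, but not on the rate or the probability space.\<close>

theorem corollary12:
  shows "\<exists>C1>0. \<exists>C2>0. \<forall>\<delta>::real. 0 < \<delta> \<and> \<delta> < 1 \<longrightarrow>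
    (\<forall>\<^sub>F n in sequentially.
      explore_len n \<delta> < n \<and>
      (\<forall>(\<theta>::real) (M::'a measure) (X::nat \<Rightarrow> 'a \<Rightarrow> real).
        \<theta> > 0 \<and> prob_space M \<and>
        prob_space.indep_vars M (\<lambda>_. borel) X {1..n} \<and>
        (\<forall>i\<in>{1..n}. distributed M lborel (X i) (exponential_density \<theta>)) \<longrightarrow>
        CR M n X (\<lambda>\<omega>. cdp_ol n (explore_len n \<delta>) \<delta> (\<lambda>i. X i \<omega>))
          \<ge> (1 - \<delta>) *
             (1 - C1 * (ln (1 / \<delta>) powr (1 / 3) / (real n * ln (real n)) powr (1 / 3))
                - C2 * (1 / ln (real n)))))"
proof (rule exI[of _ 1], rule conjI[OF zero_less_one], rule exI[of _ 4], rule conjI, simp, intro allI impI)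
  fix \<delta> :: real assume \<delta>: "0 < \<delta> \<and> \<delta> < 1"
  define c where "c = ln (1 / \<delta>) powr (1 / 3)"
  define K where "K = 4 * ln (2 / \<delta>)"
  have "ln (1 / \<delta>) > 0" "c > 0" "K > 0" using \<delta> by (auto simp: c_def K_def)
  define b where "b = (\<lambda>n. (real n * ln (real n)) powr (2 / 3) * c)"
  \<comment> \<open>\<open>b n\<close> is the exploration length before rounding, of order
    \<open>(n * ln n) powr (2 / 3)\<close>. It stays below half the horizon even when rounded up,
    and it exceeds any multiple of \<open>(ln n)\<^sup>2\<close>, as needed for the failure
    probability and for the confidence width.\<close>
  have "\<forall>\<^sub>F n in sequentially. 2 * (b n + 1) \<le> real n"
    unfolding b_def using \<open>c > 0\<close> by real_asymp
  moreover have "\<forall>\<^sub>F n in sequentially. 64 * (ln (real n))\<^sup>2 \<le> \<delta> * b n"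
    unfolding b_def using \<open>c > 0\<close> \<delta> by real_asymp
  moreover have "\<forall>\<^sub>F n in sequentially. K * 64 * (ln (real n))\<^sup>2 \<le> b n"
    unfolding b_def using \<open>c > 0\<close> \<open>K > 0\<close> by real_asymp
  moreover have "\<forall>\<^sub>F n in sequentially. ln (real n) \<ge> 3" by real_asymp
  ultimately show "\<forall>\<^sub>F n in sequentially.
      explore_len n \<delta> < n \<and>
      (\<forall>(\<theta>::real) (M::'a measure) (X::nat \<Rightarrow> 'a \<Rightarrow> real).
        \<theta> > 0 \<and> prob_space M \<and>
        prob_space.indep_vars M (\<lambda>_. borel) X {1..n} \<and>
        (\<forall>i\<in>{1..n}. distributed M lborel (X i) (exponential_density \<theta>)) \<longrightarrow>
        CR M n X (\<lambda>\<omega>. cdp_ol n (explore_len n \<delta>) \<delta> (\<lambda>i. X i \<omega>))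
          \<ge> (1 - \<delta>) *
             (1 - 1 * (ln (1 / \<delta>) powr (1 / 3) / (real n * ln (real n)) powr (1 / 3))
                - 4 * (1 / ln (real n))))"
  proof eventually_elim
    case (elim n)
    define m where "m = explore_len n \<delta>"
    define L where "L = ln (real n)"
    have L: "L \<ge> 3" using elim by (simp add: L_def)
    then have "0 < 64 * L\<^sup>2" by simp
    then have "0 < \<delta> * b n" using elim(2) unfolding L_def by linarith
    then have "b n > 0" using \<delta> by (simp add: zero_less_mult_iff)
    have "m = nat \<lceil>b n\<rceil>" by (simp add: m_def explore_len_def b_def c_def)
    then have m: "b n \<le> real m" "real m \<le> b n + 1" using \<open>b n > 0\<close> by linarith+
    then have "real (2 * m) \<le> real n" "0 < m" using \<open>b n > 0\<close> elim(1) by simp_all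
    then have "2 * m \<le> n" by (simp only: of_nat_le_iff)
    with \<open>0 < m\<close> have "m < n" by simp
    have fail: "64 * (ln (real n))\<^sup>2 / real m \<le> \<delta>"
    proof -
      have "64 * (ln (real n))\<^sup>2 \<le> \<delta> * real m"
        using elim(2) \<delta> by (meson m(1) mult_left_mono order.trans less_imp_le)
      then show ?thesis using \<open>0 < m\<close> by (simp add: field_simps)
    qed
    have "K / real m \<le> (1 / (8 * L))\<^sup>2"
      using elim(3) m(1) \<open>0 < m\<close> L by (simp add: field_simps power2_eq_square L_def)
    then have width: "0 \<le> conf_width m \<delta>" "conf_width m \<delta> \<le> 1 / (8 * ln (real n))"
      using \<open>K > 0\<close> L by (auto simp: conf_width_def K_def[symmetric] L_def[symmetric] intro!: real_le_lsqrt)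
    \<comment> \<open>The constant 4 is that of \<open>CR_lower_bound\<close>; the first error term
      is nonnegative, so subtracting it only weakens the bound.\<close>
    have "(1 - \<delta>) * (1 - 1 * (ln (1 / \<delta>) powr (1 / 3) / (real n * ln (real n)) powr (1 / 3))
        - 4 * (1 / ln (real n))) \<le> (1 - \<delta>) * (1 - 4 / ln (real n))"
      using \<delta> by (intro mult_left_mono) auto
    moreover have "(1 - \<delta>) * (1 - 4 / ln (real n)) \<le> CR M n X (\<lambda>\<omega>. cdp_ol n m \<delta> (\<lambda>i. X i \<omega>))"
      if "\<theta> > 0" "prob_space M" "prob_space.indep_vars M (\<lambda>_. borel) X {1..n}"
        "\<forall>i\<in>{1..n}. distributed M lborel (X i) (exponential_density \<theta>)"
      for \<theta> and M :: "'a measure" and X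
    proof -
      interpret prob_space M by fact
      interpret iid_exponential M X n m \<theta> \<delta>
        by unfold_locales (use that \<open>m < n\<close> in auto)
      show ?thesis
        using \<open>0 < m\<close> \<open>2 * m \<le> n\<close> elim \<delta> width fail by (intro CR_lower_bound) auto
    qed
    ultimately show ?case
      using \<open>m < n\<close> unfolding m_def[symmetric] by (auto intro: order.trans)
  qed
qed

end
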